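(* Let $1<\alpha(\omega)<3$, $0<\beta(\omega)<2$, $0\le\lambda(\omega)<1$, $m_{\mathrm{eff}}>0$ and $|\zeta_{\mathrm{eff}}|\le1$. Let $h(t)$ be the (restricted) impulse response of the variable-order fractional vibrator $m x^{(\alpha(\omega))}(t)+c x^{(\beta(\omega))}(t)+k x^{(\lambda(\omega))}(t)=f(t)$, i.e. the solution of $$m\frac{d^{\alpha(\omega)}h(t)}{dt^{\alpha(\omega)}}+c\frac{d^{\beta(\omega)}h(t)}{dt^{\beta(\omega)}}+k\frac{d^{\lambda(\omega)}h(t)}{dt^{\lambda(\omega)}}=\delta(t)$$ with zero initial conditions. Then $$h(t)=e^{-\zeta_{\mathrm{eff}}\omega_{\mathrm{effn}}t}\,\frac{1}{m_{\mathrm{eff}}\omega_{\mathrm{effd}}}\sin\omega_{\mathrm{effd}}t,\qquad t\ge0.$$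
   Context: $m,c,k>0$ are constants, $\alpha,\beta,\lambda$ are real functions of frequency $\omega>0$, and $\delta$ is the Dirac delta. Define $$m_{\mathrm{eff}}=-\left[m\omega^{\alpha(\omega)-2}\cos\frac{\alpha(\omega)\pi}{2}+c\omega^{\beta(\omega)-2}\cos\frac{\beta(\omega)\pi}{2}\right],$$ $$c_{\mathrm{eff}}=m\omega^{\alpha(\omega)-1}\sin\frac{\alpha(\omega)\pi}{2}+c\omega^{\beta(\omega)-1}\sin\frac{\beta(\omega)\pi}{2}+k\omega^{\lambda(\omega)-1}\sin\frac{\lambda(\omega)\pi}{2},\qquad k_{\mathrm{eff}}=k\omega^{\lambda(\omega)}\cos\frac{\lambda(\omega)\pi}{2},$$ $$\zeta_{\mathrm{eff}}=\frac{c_{\mathrm{eff}}}{2\sqrt{m_{\mathrm{eff}}k_{\mathrm{eff}}}},\qquad\omega_{\mathrm{effn}}=\sqrt{\frac{k_{\mathrm{eff}}}{m_{\mathrm{eff}}}},\qquad\omega_{\mathrm{effd}}=\omega_{\mathrm{effn}}\sqrt{1-\zeta_{\mathrm{eff}}^2}.$$ The fractional equation is understood through its equivalent form $$m_{\mathrm{eff}}\frac{d^2h(t)}{dt^2}+c_{\mathrm{eff}}\frac{dh(t)}{dt}+k_{\mathrm{eff}}h(t)=\delta(t),$$ in which $\omega$ is a parameter independent of $t$; $h$ is the causal solution ($h(t)=0$ for $t<0$). When $\omega_{\mathrm{effd}}=0$, $\frac{\sin\omega_{\mathrm{effd}}t}{\omega_{\mathrm{effd}}}$ is read as its limit $t$.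 *)

theory Defs
  imports "HOL-Analysis.Analysis"
begin

section \<open>Distributions on the real line\<close>

definition test_function :: "(real \<Rightarrow> real) \<Rightarrow> bool" where
  "test_function \<phi> \<longleftrightarrow>
     (\<forall>n x. (deriv ^^ n) \<phi> differentiable (at x)) \<and> compact (closure {x. \<phi> x \<noteq> 0})"

definition locally_integrable :: "(real \<Rightarrow> real) \<Rightarrow> bool" where
  "locally_integrable h \<longleftrightarrow> (\<forall>K. compact K \<longrightarrow> set_integrable lebesgue K h)"

text \<open>A distribution is represented by its action on functions; only its values on test
  functions are ever used.\<close>

type_synonym distribution = "(real \<Rightarrow> real) \<Rightarrow> real"

definition regular_dist :: "(real \<Rightarrow> real) \<Rightarrow> distribution" where
  "regular_dist h = (\<lambda>\<phi>. LINT t|lebesgue. h t * \<phi> t)"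

definition dirac_delta :: distribution where
  "dirac_delta = (\<lambda>\<phi>. \<phi> 0)"

definition dist_deriv :: "distribution \<Rightarrow> distribution" where
  "dist_deriv T = (\<lambda>\<phi>. - T (deriv \<phi>))"

section \<open>Effective parameters of the variable-order fractional vibrator\<close>

text \<open>\<open>lam\<close> stands for the order function written lambda in the mathematics.\<close>

definition m_eff ::
  "real \<Rightarrow> real \<Rightarrow> (real \<Rightarrow> real) \<Rightarrow> (real \<Rightarrow> real) \<Rightarrow> real \<Rightarrow> real" where
  "m_eff m c \<alpha> \<beta> \<omega> =
     - (m * \<omega> powr (\<alpha> \<omega> - 2) * cos (\<alpha> \<omega> * pi / 2)
        + c * \<omega> powr (\<beta> \<omega> - 2) * cos (\<beta> \<omega> * pi / 2))"

definition c_eff ::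
  "real \<Rightarrow> real \<Rightarrow> real \<Rightarrow> (real \<Rightarrow> real) \<Rightarrow> (real \<Rightarrow> real) \<Rightarrow> (real \<Rightarrow> real) \<Rightarrow> real \<Rightarrow> real" where
  "c_eff m c k \<alpha> \<beta> lam \<omega> =
     m * \<omega> powr (\<alpha> \<omega> - 1) * sin (\<alpha> \<omega> * pi / 2)
     + c * \<omega> powr (\<beta> \<omega> - 1) * sin (\<beta> \<omega> * pi / 2)
     + k * \<omega> powr (lam \<omega> - 1) * sin (lam \<omega> * pi / 2)"

definition k_eff :: "real \<Rightarrow> (real \<Rightarrow> real) \<Rightarrow> real \<Rightarrow> real" where
  "k_eff k lam \<omega> = k * \<omega> powr (lam \<omega>) * cos (lam \<omega> * pi / 2)"

definition zeta_eff ::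
  "real \<Rightarrow> real \<Rightarrow> real \<Rightarrow> (real \<Rightarrow> real) \<Rightarrow> (real \<Rightarrow> real) \<Rightarrow> (real \<Rightarrow> real) \<Rightarrow> real \<Rightarrow> real" where
  "zeta_eff m c k \<alpha> \<beta> lam \<omega> =
     c_eff m c k \<alpha> \<beta> lam \<omega> / (2 * sqrt (m_eff m c \<alpha> \<beta> \<omega> * k_eff k lam \<omega>))"

definition omega_effn ::
  "real \<Rightarrow> real \<Rightarrow> real \<Rightarrow> (real \<Rightarrow> real) \<Rightarrow> (real \<Rightarrow> real) \<Rightarrow> (real \<Rightarrow> real) \<Rightarrow> real \<Rightarrow> real" where
  "omega_effn m c k \<alpha> \<beta> lam \<omega> = sqrt (k_eff k lam \<omega> / m_eff m c \<alpha> \<beta> \<omega>)"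

definition omega_effd ::
  "real \<Rightarrow> real \<Rightarrow> real \<Rightarrow> (real \<Rightarrow> real) \<Rightarrow> (real \<Rightarrow> real) \<Rightarrow> (real \<Rightarrow> real) \<Rightarrow> real \<Rightarrow> real" where
  "omega_effd m c k \<alpha> \<beta> lam \<omega> =
     omega_effn m c k \<alpha> \<beta> lam \<omega> * sqrt (1 - (zeta_eff m c k \<alpha> \<beta> lam \<omega>)\<^sup>2)"

section \<open>Impulse response\<close>

text \<open>The fractional equation is understood through its equivalent second-order form with
  effective coefficients, in which \<open>\<omega>\<close> is a parameter independent of time. Since the forcing
  is a Dirac delta, the equation is an identity of distributions. The zero initial conditions
  (the system is at rest before the impulse) are the vanishing of \<open>h\<close> on the negative half
  line; a condition on the classical derivative at \<open>0\<close> would be wrong, because the impulse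
  makes the velocity jump there. This determines \<open>h\<close> up to null sets.\<close>

definition vo_impulse_response ::
  "real \<Rightarrow> real \<Rightarrow> real \<Rightarrow> (real \<Rightarrow> real) \<Rightarrow> (real \<Rightarrow> real) \<Rightarrow> (real \<Rightarrow> real) \<Rightarrow> real
    \<Rightarrow> (real \<Rightarrow> real) \<Rightarrow> bool" where
  "vo_impulse_response m c k \<alpha> \<beta> lam \<omega> h \<longleftrightarrow>
     locally_integrable h \<and> (\<forall>t<0. h t = 0) \<and>
     (\<forall>\<phi>. test_function \<phi> \<longrightarrow>
        m_eff m c \<alpha> \<beta> \<omega> * dist_deriv (dist_deriv (regular_dist h)) \<phi>
        + c_eff m c k \<alpha> \<beta> lam \<omega> * dist_deriv (regular_dist h) \<phi>
        + k_eff k lam \<omega> * regular_dist h \<phi> = dirac_delta \<phi>)"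

text \<open>\<open>sin (w t) / w\<close>, read as its limit \<open>t\<close> when \<open>w = 0\<close>.\<close>

definition sin_quot :: "real \<Rightarrow> real \<Rightarrow> real" where
  "sin_quot w t = (if w = 0 then t else sin (w * t) / w)"

end

theory Submission
  imports Defs
begin

text \<open>
  With \<open>M\<close>, \<open>C\<close>, \<open>K\<close> the effective mass, damping and stiffness, the equation of the vibrator is
  \<open>M h\<^sup>\<prime>\<^sup>\<prime> + C h\<^sup>\<prime> + K h = \<delta>\<close> with constant coefficients. Here \<open>K > 0\<close> because the order of the
  restoring term lies in \<open>[0, 1)\<close>, and \<open>\<bar>\<zeta>\<bar> \<le> 1\<close> allows completing the square: with
  \<open>\<sigma> = \<zeta> \<omega>n\<close> and \<open>w = \<omega>d\<close> one has \<open>C = 2 M \<sigma>\<close> and \<open>K = M (\<sigma>\<^sup>2 + w\<^sup>2)\<close>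
  (\<open>effective_parameters_complete_square\<close>). The claim becomes one about the causal fundamental
  solution of \<open>M (D\<^sup>2 + 2 \<sigma> D + \<sigma>\<^sup>2 + w\<^sup>2)\<close>.

  Existence (\<open>causal_response_solves\<close>) is Green's identity on the half-line: integrating the
  formula against the adjoint operator applied to a test function \<open>\<phi>\<close> leaves only the boundary term
  \<open>\<phi> 0\<close>, produced by the initial velocity \<open>1 / M\<close>.

  Uniqueness up to null sets (\<open>fundamental_solution_unique\<close>) is by duality. Each test function
  \<open>\<psi>\<close> is the image under the adjoint operator of a smooth function vanishing for large times, found
  by solving the adjoint equation backward in time (\<open>adjoint_equation_solvable\<close>). Causal functions
  do not see its behaviour at negative times, so it may be cut off there to become a test function.
  Hence the difference of two solutions integrates to \<open>0\<close> against every \<open>\<psi>\<close>, and it vanishes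
  almost everywhere by \<open>fundamental_lemma_of_variations\<close>. For solutions continuous on the closed
  half-line, equality almost everywhere becomes equality at each \<open>t \<ge> 0\<close>.
\<close>

section \<open>Smooth functions on the real line\<close>

text \<open>The recursion peels off the innermost derivative. Closure of this class under products
  then needs only the product rule for a first derivative, by induction on the order; the iterated
  derivatives \<open>(deriv ^^ n) f\<close> would call for the Leibniz formula.\<close>

primrec times_differentiable :: "nat \<Rightarrow> (real \<Rightarrow> real) \<Rightarrow> bool" where
  "times_differentiable 0 f \<longleftrightarrow> True"
| "times_differentiable (Suc n) f \<longleftrightarrow>
     (\<forall>x. f differentiable (at x)) \<and> times_differentiable n (deriv f)"

definition smooth :: "(real \<Rightarrow> real) \<Rightarrow> bool" where
  "smooth f \<longleftrightarrow> (\<forall>n. times_differentiable n f)"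

lemma times_differentiable_SucI:
  assumes "\<And>x. (f has_real_derivative f' x) (at x)" "times_differentiable n f'"
  shows "times_differentiable (Suc n) f"
proof -
  have "deriv f = f'" using assms(1) by (auto intro!: DERIV_imp_deriv)
  then show ?thesis using assms by (auto simp: real_differentiable_def)
qed

lemma times_differentiable_Suc_has_deriv:
  "times_differentiable (Suc n) f \<Longrightarrow> (f has_real_derivative deriv f x) (at x)"
  by (simp add: DERIV_deriv_iff_real_differentiable)

lemma times_differentiable_SucD: "times_differentiable (Suc n) f \<Longrightarrow> times_differentiable n f"
  by (induction n arbitrary: f) auto

lemma times_differentiable_const: "times_differentiable n (\<lambda>x. c)"
proof (induction n arbitrary: c)
  case (Suc n)
  show ?case by (rule times_differentiable_SucI[OF _ Suc[of 0]]) simp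
qed simp

lemma times_differentiable_add:
  "times_differentiable n f \<Longrightarrow> times_differentiable n g \<Longrightarrow> times_differentiable n (\<lambda>x. f x + g x)"
proof (induction n arbitrary: f g)
  case (Suc n)
  note d = Suc.prems[THEN times_differentiable_Suc_has_deriv]
  show ?case
    by (rule times_differentiable_SucI[OF DERIV_add[OF d]]) (use Suc in simp)
qed simp

lemma times_differentiable_mult:
  "times_differentiable n f \<Longrightarrow> times_differentiable n g \<Longrightarrow> times_differentiable n (\<lambda>x. f x * g x)"
proof (induction n arbitrary: f g)
  case (Suc n)
  note d = Suc.prems[THEN times_differentiable_Suc_has_deriv]
  note l = Suc.prems[THEN times_differentiable_SucD]
  show ?case
    by (rule times_differentiable_SucI[OF DERIV_mult[OF d]])
       (use Suc l in \<open>auto intro!: times_differentiable_add\<close>)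
qed simp

lemma times_differentiable_cmult:
  "times_differentiable n f \<Longrightarrow> times_differentiable n (\<lambda>x. c * f x)"
  by (intro times_differentiable_mult times_differentiable_const)

lemma times_differentiable_inverse:
  "times_differentiable n f \<Longrightarrow> (\<And>x. f x \<noteq> 0) \<Longrightarrow> times_differentiable n (\<lambda>x. inverse (f x))"
proof (induction n)
  case (Suc n)
  note l = Suc.prems(1)[THEN times_differentiable_SucD]
  have d: "((\<lambda>x. inverse (f x)) has_real_derivative
          (-1) * (deriv f x * (inverse (f x) * inverse (f x)))) (at x)" for x
    using DERIV_inverse_fun[OF times_differentiable_Suc_has_deriv[OF Suc.prems(1), of x] Suc.prems(2)]
    by (simp add: power2_eq_square mult.assoc)
  show ?case
    by (rule times_differentiable_SucI[OF d], intro times_differentiable_cmult times_differentiable_mult)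
       (use Suc l in auto)
qed simp

lemma times_differentiable_affine:
  "times_differentiable n f \<Longrightarrow> times_differentiable n (\<lambda>x. f (a * x + b))"
proof (induction n arbitrary: f)
  case (Suc n)
  have d: "((\<lambda>x. f (a * x + b)) has_real_derivative a * deriv f (a * x + b)) (at x)" for x
  proof -
    have "((\<lambda>x. a * x + b) has_real_derivative a) (at x)"
      by (auto intro!: derivative_eq_intros)
    from DERIV_chain2[OF times_differentiable_Suc_has_deriv[OF Suc.prems] this]
    show ?thesis by (simp add: mult.commute)
  qed
  show ?case
    by (rule times_differentiable_SucI[OF d], rule times_differentiable_cmult)
       (use Suc in auto)
qed simp

lemma smooth_has_deriv: "smooth f \<Longrightarrow> (f has_real_derivative deriv f x) (at x)"
  unfolding smooth_def using times_differentiable_Suc_has_deriv by blast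

lemma smooth_deriv: "smooth f \<Longrightarrow> smooth (deriv f)"
  unfolding smooth_def using times_differentiable.simps(2) by blast

lemma smooth_antideriv:
  assumes "\<And>x. (f has_real_derivative f' x) (at x)" "smooth f'"
  shows "smooth f"
  unfolding smooth_def
proof
  fix n show "times_differentiable n f"
    using times_differentiable_SucD[OF times_differentiable_SucI[OF assms(1)]] assms(2)
    by (auto simp: smooth_def)
qed

lemma smooth_const: "smooth (\<lambda>x. c)"
  by (simp add: smooth_def times_differentiable_const)

lemma smooth_add: "smooth f \<Longrightarrow> smooth g \<Longrightarrow> smooth (\<lambda>x. f x + g x)"
  by (simp add: smooth_def times_differentiable_add)

lemma smooth_mult: "smooth f \<Longrightarrow> smooth g \<Longrightarrow> smooth (\<lambda>x. f x * g x)"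
  by (simp add: smooth_def times_differentiable_mult)

lemma smooth_inverse: "smooth f \<Longrightarrow> (\<And>x. f x \<noteq> 0) \<Longrightarrow> smooth (\<lambda>x. inverse (f x))"
  by (simp add: smooth_def times_differentiable_inverse)

lemma smooth_affine: "smooth f \<Longrightarrow> smooth (\<lambda>x. f (a * x + b))"
  by (simp add: smooth_def times_differentiable_affine)

lemma smooth_continuous: "smooth f \<Longrightarrow> continuous_on A f"
  by (meson DERIV_isCont continuous_at_imp_continuous_on smooth_has_deriv)

lemma smooth_iff_iterated_deriv: "smooth f \<longleftrightarrow> (\<forall>n x. (deriv ^^ n) f differentiable (at x))"
proof
  have "(\<forall>x. (deriv ^^ n) f differentiable (at x))" if "smooth f" for n f
    using that
  proof (induction n arbitrary: f)
    case 0 then show ?case using smooth_has_deriv by (auto simp: real_differentiable_def)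
  next
    case (Suc n) then show ?case using smooth_deriv by (auto simp: funpow_swap1[symmetric] simp del: funpow.simps) (metis funpow_Suc_right o_apply)
  qed
  then show "smooth f \<Longrightarrow> \<forall>n x. (deriv ^^ n) f differentiable (at x)" by blast
next
  have "times_differentiable n f" if "\<forall>n x. (deriv ^^ n) f differentiable (at x)" for n f
    using that
  proof (induction n arbitrary: f)
    case (Suc n)
    have "\<forall>x. f differentiable (at x)" using Suc.prems by (metis funpow_0)
    moreover have "times_differentiable n (deriv f)"
      by (rule Suc.IH) (metis Suc.prems funpow_Suc_right o_apply)
    ultimately show ?case by simp
  qed simp
  then show "\<forall>n x. (deriv ^^ n) f differentiable (at x) \<Longrightarrow> smooth f"
    by (auto simp: smooth_def)
qed

section \<open>Cut-off functions\<close>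

text \<open>Differentiating \<open>exp (- 1 / x)\<close> produces negative powers of \<open>x\<close> as factors. The functions
  \<open>exp (- 1 / x) / x ^ k\<close> for all \<open>k\<close> together span a space closed under differentiation, which
  makes the smoothness of every one of them an induction on the order.\<close>

definition flat_exp :: "nat \<Rightarrow> real \<Rightarrow> real" where
  "flat_exp k x = (if x > 0 then exp (- (1 / x)) / x ^ k else 0)"

lemma tendsto_flat_exp: "((\<lambda>x. flat_exp k x) \<longlongrightarrow> 0) (at 0)"
proof -
  have "((\<lambda>y::real. y ^ k / exp y) \<longlongrightarrow> 0) at_top" by (rule tendsto_power_div_exp_0)
  then have "((\<lambda>x::real. inverse x ^ k / exp (inverse x)) \<longlongrightarrow> 0) (at_right 0)"
    by (rule filterlim_compose[OF _ filterlim_inverse_at_top_right])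
  then have "(flat_exp k \<longlongrightarrow> 0) (at_right 0)"
    by (rule Lim_transform_eventually)
       (auto simp: eventually_at_filter flat_exp_def exp_minus field_simps)
  moreover have "(flat_exp k \<longlongrightarrow> 0) (at_left 0)"
    by (rule Lim_transform_eventually[OF tendsto_const])
       (auto simp: eventually_at_filter flat_exp_def)
  ultimately show ?thesis by (simp add: filterlim_split_at)
qed

text \<open>At \<open>0\<close> the difference quotient of the function with index \<open>k\<close> is the function with index
  \<open>Suc k\<close>, so the derivative there is the limit at \<open>0\<close> of a member of the same family.\<close>

lemma flat_exp_has_deriv:
  "(flat_exp k has_real_derivative flat_exp (k + 2) x + - real k * flat_exp (k + 1) x) (at x)"
proof -
  consider "x > 0" | "x < 0" | "x = 0" by linarith
  then show ?thesis
  proof cases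
    case 1
    have "((\<lambda>x. exp (- (1 / x)) / x ^ k) has_real_derivative
            flat_exp (k + 2) x + - real k * flat_exp (k + 1) x) (at x)"
      using 1 by (auto intro!: derivative_eq_intros simp: flat_exp_def)
        (cases k, auto simp: field_simps power2_eq_square)
    then show ?thesis
      by (rule has_field_derivative_transform_within_open[where S = "{0<..}"])
         (use 1 in \<open>auto simp: flat_exp_def\<close>)
  next
    case 2
    have "((\<lambda>x. 0) has_real_derivative
            flat_exp (k + 2) x + - real k * flat_exp (k + 1) x) (at x)"
      using 2 by (simp add: flat_exp_def)
    then show ?thesis
      by (rule has_field_derivative_transform_within_open[where S = "{..<0}"])
         (use 2 in \<open>auto simp: flat_exp_def\<close>)
  next
    case 3
    have "((\<lambda>h. (flat_exp k (0 + h) - flat_exp k 0) / h) \<longlongrightarrow> 0) (at 0)"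
      by (rule Lim_transform_eventually[OF tendsto_flat_exp[of "Suc k"]])
         (auto simp: flat_exp_def eventually_at_filter)
    then show ?thesis using 3 by (simp add: DERIV_def flat_exp_def)
  qed
qed

lemma smooth_flat_exp: "smooth (flat_exp k)"
proof -
  have "times_differentiable n (flat_exp k)" for n
  proof (induction n arbitrary: k)
    case (Suc n)
    show ?case
      by (rule times_differentiable_SucI[OF flat_exp_has_deriv])
         (intro times_differentiable_add times_differentiable_cmult Suc)
  qed simp
  then show ?thesis by (simp add: smooth_def)
qed

text \<open>With \<open>E = flat_exp 0\<close>, the cut-off is \<open>E (x + 2) / (E (x + 2) + E (- 1 - x))\<close>: the two
  arguments have positive sum, so the denominator never vanishes. Having the plateau start at \<open>- 1\<close>
  rather than \<open>0\<close> makes the cut-off identically \<open>1\<close> in a neighbourhood of the half-line \<open>t \<ge> 0\<close>,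
  so that multiplying by it does not disturb derivatives there.\<close>

lemma smooth_cutoff:
  obtains \<eta> where "smooth \<eta>" "\<And>x. x \<ge> -1 \<Longrightarrow> \<eta> x = 1" "\<And>x. x \<le> -2 \<Longrightarrow> \<eta> x = 0"
proof
  let ?D = "\<lambda>x. flat_exp 0 (1 * x + 2) + flat_exp 0 ((-1) * x + (-1))"
  have pos: "?D x \<noteq> 0" for x
  proof -
    have "flat_exp 0 y \<ge> 0" for y by (simp add: flat_exp_def)
    moreover have "flat_exp 0 (1 * x + 2) > 0 \<or> flat_exp 0 ((-1) * x + (-1)) > 0"
      by (auto simp: flat_exp_def)
    ultimately show ?thesis by (smt (verit))
  qed
  show "smooth (\<lambda>x. flat_exp 0 (1 * x + 2) * inverse (?D x))"
    by (intro smooth_mult smooth_inverse smooth_add smooth_affine smooth_flat_exp pos)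
qed (auto simp: flat_exp_def)

lemma test_function_iff:
  "test_function \<phi> \<longleftrightarrow> smooth \<phi> \<and> (\<exists>a b. \<forall>x. x \<notin> {a..b} \<longrightarrow> \<phi> x = 0)"
proof -
  have "compact (closure {x. \<phi> x \<noteq> 0}) \<longleftrightarrow> bounded {x. \<phi> x \<noteq> 0}"
    by (meson bounded_closure_image bounded_subset closure_subset compact_closure)
  also have "\<dots> \<longleftrightarrow> (\<exists>a b. {x. \<phi> x \<noteq> 0} \<subseteq> {a..b})"
    by (metis bounded_closed_interval bounded_subset bounded_subset_cbox_symmetric interval_cbox)
  also have "\<dots> \<longleftrightarrow> (\<exists>a b. \<forall>x. x \<notin> {a..b} \<longrightarrow> \<phi> x = 0)" by blast
  finally show ?thesis by (simp add: test_function_def smooth_iff_iterated_deriv)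
qed

lemma deriv_eq_0_outside:
  fixes f :: "real \<Rightarrow> real"
  assumes "\<forall>x. x \<notin> {a..b} \<longrightarrow> f x = 0" "x \<notin> {a..b}"
  shows "deriv f x = 0"
proof -
  have "(f has_real_derivative 0) (at x)"
    by (rule has_field_derivative_transform_within_open[where S = "- {a..b}" and f = "\<lambda>x. 0"])
       (use assms in auto)
  then show ?thesis by (rule DERIV_imp_deriv)
qed

section \<open>The fundamental lemma of the calculus of variations\<close>

lemma sigma_finite_lebesgue: "sigma_finite_measure (lebesgue :: real measure)"
proof
  obtain A :: "real set set" where "countable A" "A \<subseteq> sets lborel" "\<Union>A = space lborel"
    "\<forall>a\<in>A. emeasure lborel a \<noteq> \<infinity>"
    using lborel.sigma_finite_countable by blast
  then show "\<exists>A::real set set. countable A \<and> A \<subseteq> sets lebesgue \<and> \<Union>A = space lebesgue \<and>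
      (\<forall>a\<in>A. emeasure lebesgue a \<noteq> \<infinity>)"
    by (intro exI[of _ A]) (auto simp: subset_iff)
qed

text \<open>The sets over which \<open>f\<close> integrates to \<open>0\<close> form a Dynkin system. It contains the rays, which are
  stable under intersection and generate the Borel sets, hence it contains all Borel sets and, up to
  null sets, all Lebesgue sets.\<close>

lemma AE_eq_0_if_integral_rays_eq_0:
  fixes f :: "real \<Rightarrow> real"
  assumes int: "integrable lebesgue f" and total: "integral\<^sup>L lebesgue f = 0"
    and rays: "\<And>x. (LINT t:{x<..}|lebesgue. f t) = 0"
  shows "AE x in lebesgue. f x = 0"
proof (rule sigma_finite_measure.density_zero[OF sigma_finite_lebesgue int])
  have si: "set_integrable lebesgue A f" if "A \<in> sets borel" for A
    unfolding set_integrable_def using int that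
    by (intro integrable_mult_indicator) auto
  have borel: "(LINT t:A|lebesgue. f t) = 0" if "A \<in> sets borel" for A
  proof -
    have sb: "sigma_sets UNIV (range greaterThan) = sets (borel :: real measure)"
      by (simp add: borel_Ioi)
    have "Int_stable (range (greaterThan :: real \<Rightarrow> real set))"
      by (auto simp: Int_stable_def lessThan_Int_lessThan)
    moreover have "range greaterThan \<subseteq> Pow (UNIV :: real set)" by simp
    moreover have "A \<in> sigma_sets UNIV (range greaterThan)" using that sb by simp
    ultimately show ?thesis
    proof (induction rule: sigma_sets_induct_disjoint)
      case (basic A) then show ?case using rays by auto
    next
      case empty then show ?case by (simp add: set_lebesgue_integral_def)
    next
      case (compl A)
      then have A: "A \<in> sets borel" using sb by simp
      have "integral\<^sup>L lebesgue f = (LINT t:A \<union> (UNIV - A)|lebesgue. f t)"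
        by (simp add: set_lebesgue_integral_def)
      also have "\<dots> = (LINT t:A|lebesgue. f t) + (LINT t:UNIV - A|lebesgue. f t)"
        using A by (intro set_integral_Un si) auto
      finally show ?case using compl total by simp
    next
      case (union A)
      then have A: "A i \<in> sets borel" for i using sb by auto
      have "(LINT t:(\<Union>i. A i)|lebesgue. f t) = (\<Sum>i. LINT t:A i|lebesgue. f t)"
        using A union.hyps(1)
        by (intro lebesgue_integral_countable_add si) (auto simp: disjoint_family_on_def)
      then show ?case using union by simp
    qed
  qed
  fix A :: "real set" assume "A \<in> sets lebesgue"
  then obtain S N N' where A: "A = S \<union> N" "N \<subseteq> N'" "N' \<in> null_sets lborel" "S \<in> sets lborel"
    by (rule sets_completionE)
  have "N' \<in> null_sets lebesgue" using A(3) by (rule null_sets_completionI)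
  then have "AE x in lebesgue. x \<notin> N'" by (rule AE_not_in)
  then have "AE x in lebesgue. indicat_real A x *\<^sub>R f x = indicat_real S x *\<^sub>R f x"
    by eventually_elim (use A in \<open>auto simp: indicator_def\<close>)
  moreover have "A \<in> sets lebesgue" by fact
  ultimately have "(LINT t:A|lebesgue. f t) = (LINT t:S|lebesgue. f t)"
    unfolding set_lebesgue_integral_def using int A
    by (intro integral_cong_AE borel_measurable_integrable integrable_mult_indicator) auto
  then show "(LINT t:A|lebesgue. f t) = 0" using borel A by simp
qed

text \<open>A continuous function supported in an interval is bounded, so the product is dominated by a
  multiple of \<open>h\<close> restricted to that interval.\<close>

lemma locally_integrable_mult_continuous:
  assumes h: "locally_integrable h" and c: "continuous_on UNIV \<phi>"
    and z: "\<forall>x. x \<notin> {a..b} \<longrightarrow> \<phi> x = 0"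
  shows "integrable lebesgue (\<lambda>t. h t * \<phi> t)"
proof -
  let ?g = "\<lambda>t. indicat_real {a..b} t *\<^sub>R h t"
  have g: "integrable lebesgue ?g"
    using h by (simp add: locally_integrable_def set_integrable_def)
  have "bounded (\<phi> ` {a..b})"
    by (intro compact_imp_bounded compact_continuous_image continuous_on_subset[OF c]) auto
  then obtain B where B: "\<And>x. x \<in> {a..b} \<Longrightarrow> \<bar>\<phi> x\<bar> \<le> B"
    unfolding bounded_iff by force
  have eq: "h t * \<phi> t = ?g t * \<phi> t" for t using z by (auto simp: indicator_def)
  have m: "\<phi> \<in> borel_measurable lebesgue"
    using borel_measurable_continuous_onI[OF c] by (intro measurable_completion) simp
  show ?thesis unfolding eq
  proof (rule Bochner_Integration.integrable_bound)
    show "integrable lebesgue (\<lambda>t. B * ?g t)" using g by (rule integrable_mult_right)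
    show "(\<lambda>t. ?g t * \<phi> t) \<in> borel_measurable lebesgue"
      by (rule borel_measurable_times[OF borel_measurable_integrable[OF g] m])
    have "\<bar>?g t * \<phi> t\<bar> \<le> \<bar>B * ?g t\<bar>" for t
    proof (cases "t \<in> {a..b}")
      case True
      have "\<bar>\<phi> t\<bar> \<le> \<bar>B\<bar>" using B[OF True] by linarith
      then show ?thesis by (simp add: abs_mult mult.commute mult_left_mono mult_right_mono)
    qed simp
    then show "AE t in lebesgue. norm (?g t * \<phi> t) \<le> norm (B * ?g t)" by simp
  qed
qed

text \<open>Smooth functions suffice to test against intervals: with \<open>E = flat_exp 0\<close>, the products
  \<open>E (n (t - a)) E (n (b - t))\<close> are test functions with values in \<open>[0, 1]\<close> that converge pointwise
  to the indicator of the open interval from \<open>a\<close> to \<open>b\<close>. Dominated convergence gives zero integral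
  over every bounded open interval. As \<open>g\<close> need not be integrable on the whole line, the criterion
  on rays is applied to its restrictions to the intervals from \<open>- n\<close> to \<open>n\<close>.\<close>

lemma fundamental_lemma_of_variations:
  assumes g: "locally_integrable g"
    and z: "\<And>\<psi>. test_function \<psi> \<Longrightarrow> (LINT t|lebesgue. g t * \<psi> t) = 0"
  shows "AE t in lebesgue. g t = 0"
proof -
  have gint: "integrable lebesgue (\<lambda>t. indicat_real {a<..<b} t * g t)" for a b
  proof -
    have "set_integrable lebesgue {a..b} g" using g by (simp add: locally_integrable_def)
    then have "set_integrable lebesgue {a<..<b} g"
      by (rule set_integrable_subset) auto
    then show ?thesis by (simp add: set_integrable_def)
  qed
  have interval: "(LINT t|lebesgue. indicat_real {a<..<b} t * g t) = 0" for a b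
  proof -
    \<comment> \<open>The factor \<open>Suc n\<close> instead of \<open>n\<close> keeps the dilation nonzero from the start.\<close>
    define \<psi> where "\<psi> n t = flat_exp 0 (real (Suc n) * t + - (real (Suc n) * a)) *
        flat_exp 0 (- real (Suc n) * t + real (Suc n) * b)" for n t
    have pos: "0 < real (Suc n) * x \<longleftrightarrow> 0 < x" for n x by (simp add: zero_less_mult_iff)
    have psi: "\<psi> n t = (if t \<in> {a<..<b} then exp (- (1 / (t - a)) / real (Suc n)) *
         exp (- (1 / (b - t)) / real (Suc n)) else 0)" for n t
    proof -
      have e: "real (Suc n) * t + - (real (Suc n) * a) = real (Suc n) * (t - a)"
        "- real (Suc n) * t + real (Suc n) * b = real (Suc n) * (b - t)"
        by (simp_all add: algebra_simps)
      show ?thesis unfolding \<psi>_def e flat_exp_def pos by (auto simp: mult.commute)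
    qed
    have test: "test_function (\<psi> n)" for n
    proof -
      have "smooth (\<psi> n)" unfolding \<psi>_def[abs_def]
        by (intro smooth_mult smooth_affine smooth_flat_exp)
      moreover have "\<forall>x. x \<notin> {a..b} \<longrightarrow> \<psi> n x = 0" unfolding psi by auto
      ultimately show ?thesis unfolding test_function_iff by blast
    qed
    have le: "\<bar>\<psi> n t\<bar> \<le> indicat_real {a<..<b} t" for n t
      unfolding psi by (auto intro!: mult_le_one)
    have lim: "(\<lambda>n. \<psi> n t) \<longlonglongrightarrow> indicat_real {a<..<b} t" for t
    proof (cases "t \<in> {a<..<b}")
      case True
      have inv: "(\<lambda>n. c / real (Suc n)) \<longlonglongrightarrow> 0" for c
        using tendsto_mult_right[OF LIMSEQ_inverse_real_of_nat, of c]
        by (simp add: divide_inverse mult.commute)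
      have "(\<lambda>n. exp (- (1 / (t - a)) / real (Suc n)) * exp (- (1 / (b - t)) / real (Suc n)))
         \<longlonglongrightarrow> exp 0 * exp 0"
        by (intro tendsto_mult tendsto_exp inv)
      then show ?thesis unfolding psi using True by simp
    next
      case False
      then have "\<psi> n t = 0" for n unfolding psi by simp
      then show ?thesis using False by simp
    qed
    have "(\<lambda>n. LINT t|lebesgue. g t * \<psi> n t) \<longlonglongrightarrow> (LINT t|lebesgue. indicat_real {a<..<b} t * g t)"
    proof (rule integral_dominated_convergence[where w = "\<lambda>t. \<bar>indicat_real {a<..<b} t * g t\<bar>"])
      show "(\<lambda>t. indicat_real {a<..<b} t * g t) \<in> borel_measurable lebesgue"
        using gint by (rule borel_measurable_integrable)
      show "(\<lambda>t. g t * \<psi> n t) \<in> borel_measurable lebesgue" for n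
        using test[of n] locally_integrable_mult_continuous[OF g smooth_continuous]
        by (auto simp: test_function_iff intro: borel_measurable_integrable)
      show "integrable lebesgue (\<lambda>t. \<bar>indicat_real {a<..<b} t * g t\<bar>)"
        using gint by (rule integrable_abs)
      show "AE t in lebesgue. (\<lambda>n. g t * \<psi> n t) \<longlonglongrightarrow> indicat_real {a<..<b} t * g t"
        using tendsto_mult_left[OF lim] by (simp add: mult.commute)
      show "AE t in lebesgue. norm (g t * \<psi> n t) \<le> \<bar>indicat_real {a<..<b} t * g t\<bar>" for n
        using mult_right_mono[OF le abs_ge_zero[of "g _"]] by (simp add: abs_mult mult.commute)
    qed
    then show ?thesis using z[OF test] LIMSEQ_unique by (auto simp: LIMSEQ_const_iff)
  qed
  have "AE t in lebesgue. indicat_real {- real n<..<real n} t * g t = 0" for n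
  proof (rule AE_eq_0_if_integral_rays_eq_0[OF gint interval])
    fix x
    have "indicat_real {x<..} t *\<^sub>R (indicat_real {- real n<..<real n} t * g t)
      = indicat_real {max x (- real n)<..<real n} t * g t" for t
      by (auto simp: indicator_def)
    then show "(LINT t:{x<..}|lebesgue. indicat_real {- real n<..<real n} t * g t) = 0"
      unfolding set_lebesgue_integral_def by (simp only: interval)
  qed
  then have "AE t in lebesgue. \<forall>n. indicat_real {- real n<..<real n} t * g t = 0"
    unfolding AE_all_countable by blast
  then show ?thesis
  proof eventually_elim
    fix t assume *: "\<forall>n. indicat_real {- real n<..<real n} t * g t = 0"
    obtain n where "\<bar>t\<bar> < real n" using reals_Archimedean2 by blast
    then have "t \<in> {- real n<..<real n}" by auto
    then show "g t = 0" using *[rule_format, of n] by simp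
  qed
qed

section \<open>Damped oscillators in the sense of distributions\<close>

lemma test_function_deriv: "test_function \<phi> \<Longrightarrow> test_function (deriv \<phi>)"
  unfolding test_function_iff using smooth_deriv deriv_eq_0_outside by metis

lemma integrable_mult_test_function:
  "locally_integrable h \<Longrightarrow> test_function \<phi> \<Longrightarrow> integrable lebesgue (\<lambda>t. h t * \<phi> t)"
  unfolding test_function_iff using locally_integrable_mult_continuous smooth_continuous by blast

text \<open>Two integrations by parts move the oscillator operator
  \<open>M (D\<^sup>2 + 2 \<sigma> D + \<sigma>\<^sup>2 + w\<^sup>2)\<close> onto the test function, where \<open>D\<close> becomes \<open>- D\<close>. The
  parameters \<open>\<sigma>\<close> (decay rate) and \<open>w\<close> (damped frequency) come from completing the square, and with
  real \<open>w\<close> they describe exactly the oscillators that are not overdamped.\<close>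

definition adjoint_op :: "real \<Rightarrow> real \<Rightarrow> real \<Rightarrow> (real \<Rightarrow> real) \<Rightarrow> real \<Rightarrow> real" where
  "adjoint_op M \<sigma> w \<phi> t =
     M * (deriv (deriv \<phi>) t - 2 * \<sigma> * deriv \<phi> t + (\<sigma>\<^sup>2 + w\<^sup>2) * \<phi> t)"

definition fundamental_solution :: "real \<Rightarrow> real \<Rightarrow> real \<Rightarrow> (real \<Rightarrow> real) \<Rightarrow> bool" where
  "fundamental_solution M \<sigma> w h \<longleftrightarrow> locally_integrable h \<and> (\<forall>t<0. h t = 0) \<and>
     (\<forall>\<phi>. test_function \<phi> \<longrightarrow> (LINT t|lebesgue. h t * adjoint_op M \<sigma> w \<phi> t) = \<phi> 0)"

lemma integrable_mult_adjoint_op: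
  assumes "locally_integrable h" "test_function \<phi>"
  shows "integrable lebesgue (\<lambda>t. h t * adjoint_op M \<sigma> w \<phi> t)"
    and "(LINT t|lebesgue. h t * adjoint_op M \<sigma> w \<phi> t) =
      M * (LINT t|lebesgue. h t * deriv (deriv \<phi>) t) - 2 * M * \<sigma> * (LINT t|lebesgue. h t * deriv \<phi> t)
      + M * (\<sigma>\<^sup>2 + w\<^sup>2) * (LINT t|lebesgue. h t * \<phi> t)"
proof -
  note i = integrable_mult_test_function[OF assms(1)]
  have 0: "integrable lebesgue (\<lambda>t. h t * \<phi> t)"
    and 1: "integrable lebesgue (\<lambda>t. h t * deriv \<phi> t)"
    and 2: "integrable lebesgue (\<lambda>t. h t * deriv (deriv \<phi>) t)"
    by (intro i test_function_deriv assms)+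
  have eq: "h t * adjoint_op M \<sigma> w \<phi> t = M * (h t * deriv (deriv \<phi>) t)
      - 2 * M * \<sigma> * (h t * deriv \<phi> t) + M * (\<sigma>\<^sup>2 + w\<^sup>2) * (h t * \<phi> t)" for t
    by (simp add: adjoint_op_def algebra_simps)
  show "integrable lebesgue (\<lambda>t. h t * adjoint_op M \<sigma> w \<phi> t)"
    unfolding eq
    by (intro Bochner_Integration.integrable_add Bochner_Integration.integrable_diff
        integrable_mult_right 0 1 2)
  show "(LINT t|lebesgue. h t * adjoint_op M \<sigma> w \<phi> t) =
      M * (LINT t|lebesgue. h t * deriv (deriv \<phi>) t) - 2 * M * \<sigma> * (LINT t|lebesgue. h t * deriv \<phi> t)
      + M * (\<sigma>\<^sup>2 + w\<^sup>2) * (LINT t|lebesgue. h t * \<phi> t)"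
    unfolding eq using 0 1 2 by (simp del: times_divide_eq_right)
qed

text \<open>The three distributional terms merge into one integral because each is absolutely convergent
  on its own.\<close>

lemma vo_impulse_response_iff:
  assumes "m_eff m c \<alpha> \<beta> \<omega> = M" "c_eff m c k \<alpha> \<beta> lam \<omega> = 2 * M * \<sigma>"
    "k_eff k lam \<omega> = M * (\<sigma>\<^sup>2 + w\<^sup>2)"
  shows "vo_impulse_response m c k \<alpha> \<beta> lam \<omega> h \<longleftrightarrow> fundamental_solution M \<sigma> w h"
proof -
  have "M * dist_deriv (dist_deriv (regular_dist h)) \<phi> + 2 * M * \<sigma> * dist_deriv (regular_dist h) \<phi>
      + M * (\<sigma>\<^sup>2 + w\<^sup>2) * regular_dist h \<phi> = (LINT t|lebesgue. h t * adjoint_op M \<sigma> w \<phi> t)"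
    if "locally_integrable h" "test_function \<phi>" for \<phi>
    by (simp add: integrable_mult_adjoint_op(2)[OF that] dist_deriv_def regular_dist_def)
  then show ?thesis
    unfolding vo_impulse_response_def fundamental_solution_def assms dirac_delta_def by auto
qed

section \<open>The impulse response and its uniqueness\<close>

text \<open>The derivative of \<open>sin_quot w\<close>, the derivative of the cosine written in terms of it, and the
  Pythagorean identity treat the critically damped case \<open>w = 0\<close> and the oscillating case alike, so
  that the analysis below needs no case distinction on \<open>w\<close>.\<close>

lemma has_deriv_sin_quot: "(sin_quot w has_real_derivative cos (w * t)) (at t)"
proof (cases "w = 0")
  case True
  then show ?thesis by (simp add: sin_quot_def[abs_def])
next
  case False
  then show ?thesis unfolding sin_quot_def[abs_def] by (auto intro!: derivative_eq_intros)
qed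

lemma sin_eq_sin_quot: "sin (t * w) = w * sin_quot w t"
  by (auto simp: sin_quot_def mult.commute)

lemma has_deriv_cos: "((\<lambda>t. cos (w * t)) has_real_derivative - w\<^sup>2 * sin_quot w t) (at t)"
  unfolding sin_quot_def by (auto intro!: derivative_eq_intros simp: power2_eq_square)

lemma cos_sin_quot_pythagoras: "(cos (w * t))\<^sup>2 + w\<^sup>2 * (sin_quot w t)\<^sup>2 = 1"
  by (auto simp: sin_quot_def power_divide)

lemma smooth_sin_quot: "smooth (sin_quot w)"
  and smooth_cos: "smooth (\<lambda>t. cos (w * t))"
proof -
  have "times_differentiable n (sin_quot w) \<and> times_differentiable n (\<lambda>t. cos (w * t))" for n
  proof (induction n)
    case (Suc n)
    then show ?case
      using times_differentiable_SucI[OF has_deriv_sin_quot] times_differentiable_SucI[OF has_deriv_cos]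
        times_differentiable_cmult by blast
  qed simp
  then show "smooth (sin_quot w)" "smooth (\<lambda>t. cos (w * t))" by (auto simp: smooth_def)
qed

lemma smooth_exp: "smooth (\<lambda>t. exp (a * t))"
proof -
  have "times_differentiable n (\<lambda>t. exp (a * t))" for n
  proof (induction n)
    case (Suc n)
    have "((\<lambda>t. exp (a * t)) has_real_derivative a * exp (a * t)) (at t)" for t
      by (auto intro!: derivative_eq_intros)
    then show ?case by (rule times_differentiable_SucI) (rule times_differentiable_cmult[OF Suc])
  qed simp
  then show ?thesis by (simp add: smooth_def)
qed

text \<open>Truncating only the factor \<open>sin_quot\<close> yields the causal extension, because
  \<open>sin_quot w 0 = 0\<close>, and it makes continuity at \<open>0\<close> immediate.\<close>

definition causal_response :: "real \<Rightarrow> real \<Rightarrow> real \<Rightarrow> real \<Rightarrow> real" where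
  "causal_response M \<sigma> w t = exp (- \<sigma> * t) * (1 / M) * sin_quot w (max t 0)"

lemma continuous_sin_quot: "continuous_on A (sin_quot w)"
  by (rule smooth_continuous[OF smooth_sin_quot])

lemma continuous_causal_response: "continuous_on A (causal_response M \<sigma> w)"
  unfolding causal_response_def[abs_def]
  by (intro continuous_intros continuous_on_compose2[OF continuous_sin_quot[of UNIV]]) auto

lemma locally_integrable_continuous:
  assumes "continuous_on UNIV h"
  shows "locally_integrable h"
  unfolding locally_integrable_def set_integrable_def
proof (intro allI impI)
  fix K :: "real set" assume "compact K"
  then have "integrable lborel (\<lambda>x. indicat_real K x *\<^sub>R h x)"
    by (rule borel_integrable_compact) (rule continuous_on_subset[OF assms], simp)
  then show "integrable lebesgue (\<lambda>x. indicat_real K x *\<^sub>R h x)"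
    using integrable_completion borel_measurable_integrable by blast
qed

text \<open>Let \<open>r\<close> be the response. The function
  \<open>G = M (r \<phi>\<^sup>\<prime> - r\<^sup>\<prime> \<phi>) - 2 M \<sigma> r \<phi>\<close> of Green's identity is an antiderivative of
  \<open>r (M \<phi>\<^sup>\<prime>\<^sup>\<prime> - 2 M \<sigma> \<phi>\<^sup>\<prime> + M (\<sigma>\<^sup>2 + w\<^sup>2) \<phi>)\<close> on the half-line, because \<open>r\<close> solves the
  homogeneous equation there. It vanishes beyond the support of \<open>\<phi>\<close>, and at \<open>0\<close> it equals
  \<open>- \<phi> 0\<close> since \<open>r\<close> starts at \<open>0\<close> with velocity \<open>1 / M\<close>.\<close>

lemma causal_response_solves:
  assumes "M > 0"
  shows "fundamental_solution M \<sigma> w (causal_response M \<sigma> w)"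
  unfolding fundamental_solution_def
proof (intro conjI allI impI)
  show "locally_integrable (causal_response M \<sigma> w)"
    by (rule locally_integrable_continuous[OF continuous_causal_response])
  show neg: "causal_response M \<sigma> w t = 0" if "t < 0" for t
    using that by (simp add: causal_response_def sin_quot_def)
  fix \<phi> assume t: "test_function \<phi>"
  then obtain a b where s: "smooth \<phi>" and z: "\<forall>x. x \<notin> {a..b} \<longrightarrow> \<phi> x = 0"
    by (auto simp: test_function_iff)
  note z1 = deriv_eq_0_outside[OF z]
  have z2: "deriv (deriv \<phi>) x = 0" if "x \<notin> {a..b}" for x
    using deriv_eq_0_outside[of a b "deriv \<phi>"] z1 that by blast
  \<comment> \<open>One unit past the support, so that \<open>\<phi>\<close> and its derivatives all vanish at \<open>B\<close> and beyond.\<close>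
  define B where "B = max b 0 + 1"
  have B: "B \<ge> 0" "\<And>x. x \<ge> B \<Longrightarrow> x \<notin> {a..b}" by (auto simp: B_def)
  define G where "G t = exp (- \<sigma> * t) *
      (sin_quot w t * deriv \<phi> t - cos (w * t) * \<phi> t - \<sigma> * sin_quot w t * \<phi> t)" for t
  define g where "g t = exp (- \<sigma> * t) * (1 / M) * sin_quot w t * adjoint_op M \<sigma> w \<phi> t" for t
  note d = has_deriv_sin_quot has_deriv_cos smooth_has_deriv[OF s] smooth_has_deriv[OF smooth_deriv[OF s]]
  have G: "(G has_real_derivative g t) (at t)" for t
    unfolding G_def[abs_def] g_def adjoint_op_def using assms
    by (auto intro!: derivative_eq_intros d simp: field_simps power2_eq_square sin_eq_sin_quot[of _ w])
  have "smooth (\<lambda>t. exp ((-\<sigma>) * t) * (1 / M) * sin_quot w t * (M * (deriv (deriv \<phi>) t + (- 2 * \<sigma>) * deriv \<phi> t + (\<sigma>\<^sup>2 + w\<^sup>2) * \<phi> t)))"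
    by (intro smooth_mult smooth_add smooth_const smooth_exp smooth_sin_quot smooth_deriv s)
  then have cg: "continuous_on A g" for A
    unfolding g_def[abs_def] adjoint_op_def using smooth_continuous by simp
  have "(LINT t|lebesgue. causal_response M \<sigma> w t * adjoint_op M \<sigma> w \<phi> t)
      = (LINT t|lebesgue. indicator {0..B} t *\<^sub>R g t)"
  proof (rule Bochner_Integration.integral_cong[OF refl])
    fix t :: real
    consider "t < 0" | "0 \<le> t" "t \<le> B" | "t > B" by linarith
    then show "causal_response M \<sigma> w t * adjoint_op M \<sigma> w \<phi> t = indicator {0..B} t *\<^sub>R g t"
    proof cases
      case 3
      then show ?thesis using B(2)[of t] z z1 z2 by (simp add: adjoint_op_def)
    qed (auto simp: neg causal_response_def g_def sin_quot_def)
  qed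
  also have "\<dots> = (LINT t|lborel. indicator {0..B} t *\<^sub>R g t)"
    by (rule integral_completion[OF borel_measurable_integrable[OF borel_integrable_compact]])
       (auto intro: cg)
  also have "\<dots> = G B - G 0"
    by (rule integral_FTC_Icc[OF B(1) _ cg], rule has_vector_derivative_at_within)
      (simp add: G has_real_derivative_iff_has_vector_derivative[symmetric])
  also have "\<dots> = \<phi> 0"
    using z z1 B(2)[of B] by (simp add: G_def sin_quot_def)
  finally show "(LINT t|lebesgue. causal_response M \<sigma> w t * adjoint_op M \<sigma> w \<phi> t) = \<phi> 0" .
qed

lemma antiderivative_vanishing_right:
  fixes f :: "real \<Rightarrow> real"
  assumes c: "continuous_on UNIV f" and z: "\<And>x. x > b \<Longrightarrow> f x = 0"
  obtains F where "\<And>x. (F has_real_derivative f x) (at x)" "\<And>x. x \<ge> b \<Longrightarrow> F x = 0"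
proof -
  have "\<exists>F. \<forall>x::real. - \<infinity> < ereal x \<longrightarrow> ereal x < \<infinity> \<longrightarrow> (F has_vector_derivative f x) (at x)"
    using c by (intro einterval_antiderivative) (auto simp: continuous_on_eq_continuous_at)
  then obtain F where F: "\<And>x. (F has_real_derivative f x) (at x)"
    by (auto simp: has_real_derivative_iff_has_vector_derivative)
  show ?thesis
  proof
    show "((\<lambda>x. F x - F b) has_real_derivative f x) (at x)" for x
      using DERIV_diff[OF F DERIV_const] by simp
    show "F x - F b = 0" if "x \<ge> b" for x
    proof (cases "x = b")
      case False
      then obtain u where "u > b" "F x - F b = (x - b) * f u"
        using MVT2[of b x F f] F \<open>x \<ge> b\<close> by force
      then show ?thesis using z by simp
    qed simp
  qed
qed

text \<open>The factor \<open>exp (\<sigma> t)\<close> reduces the equation to \<open>u\<^sup>\<prime>\<^sup>\<prime> + w\<^sup>2 u = f\<close>, which variation of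
  parameters solves from two antiderivatives. Choosing these to vanish to the right of the support of
  the right-hand side amounts to solving backward in time from rest, and makes \<open>\<phi>\<close> vanish there.\<close>

lemma adjoint_equation_solvable:
  assumes M: "M > 0" and \<psi>: "smooth \<psi>" "\<And>x. x > b \<Longrightarrow> \<psi> x = 0"
  obtains \<phi> where "smooth \<phi>" "\<And>t. adjoint_op M \<sigma> w \<phi> t = \<psi> t" "\<And>t. t \<ge> b \<Longrightarrow> \<phi> t = 0"
proof -
  let ?s = "sin_quot w" and ?c = "\<lambda>t. cos (w * t)"
  define f where "f t = exp ((- \<sigma>) * t) * (1 / M) * \<psi> t" for t
  have f: "smooth f" unfolding f_def[abs_def] by (intro smooth_mult smooth_exp smooth_const \<psi>)
  have sp: "smooth (\<lambda>t. (-1) * (?s t * f t))" and sq: "smooth (\<lambda>t. (-1) * (?c t * f t))"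
    by (intro smooth_mult smooth_const smooth_sin_quot smooth_cos f)+
  obtain P where P: "\<And>x. (P has_real_derivative (-1) * (?s x * f x)) (at x)" "\<And>x. x \<ge> b \<Longrightarrow> P x = 0"
    by (rule antiderivative_vanishing_right[OF smooth_continuous[OF sp], of b]) (auto simp: f_def \<psi>)
  obtain Q where Q: "\<And>x. (Q has_real_derivative (-1) * (?c x * f x)) (at x)" "\<And>x. x \<ge> b \<Longrightarrow> Q x = 0"
    by (rule antiderivative_vanishing_right[OF smooth_continuous[OF sq], of b]) (auto simp: f_def \<psi>)
  have sP: "smooth P" and sQ: "smooth Q"
    by (rule smooth_antideriv[OF P(1) sp], rule smooth_antideriv[OF Q(1) sq])
  define u where "u t = ?c t * P t + (-1) * (?s t * Q t)" for t
  define v where "v t = - w\<^sup>2 * ?s t * P t - ?c t * Q t" for t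
  have su: "smooth u" unfolding u_def[abs_def]
    by (intro smooth_add smooth_mult smooth_const smooth_sin_quot smooth_cos sP sQ)
  note d = has_deriv_sin_quot has_deriv_cos P(1) Q(1)
  have u': "(u has_real_derivative v t) (at t)" for t
    unfolding u_def[abs_def] v_def
    by (auto intro!: derivative_eq_intros d simp: algebra_simps power2_eq_square sin_eq_sin_quot[of _ w])
  have v': "(v has_real_derivative f t - w\<^sup>2 * u t) (at t)" for t
  proof -
    have "(v has_real_derivative ((?c t)\<^sup>2 + w\<^sup>2 * (?s t)\<^sup>2) * f t - w\<^sup>2 * u t) (at t)"
      unfolding u_def v_def[abs_def]
      by (auto intro!: derivative_eq_intros d simp: algebra_simps power2_eq_square sin_eq_sin_quot[of _ w])
    then show ?thesis by (simp add: cos_sin_quot_pythagoras)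
  qed
  define \<phi> where "\<phi> t = exp (\<sigma> * t) * u t" for t
  have \<phi>': "(\<phi> has_real_derivative exp (\<sigma> * t) * (\<sigma> * u t + v t)) (at t)" for t
    unfolding \<phi>_def[abs_def]
    by (auto intro!: derivative_eq_intros u' simp: algebra_simps)
  then have d1: "deriv \<phi> = (\<lambda>t. exp (\<sigma> * t) * (\<sigma> * u t + v t))"
    by (auto intro: DERIV_imp_deriv)
  have "((\<lambda>t. exp (\<sigma> * t) * (\<sigma> * u t + v t)) has_real_derivative
      exp (\<sigma> * t) * (\<sigma>\<^sup>2 * u t + 2 * \<sigma> * v t + (f t - w\<^sup>2 * u t))) (at t)" for t
    by (auto intro!: derivative_eq_intros u' v' simp: algebra_simps power2_eq_square)
  then have d2: "deriv (deriv \<phi>) t = exp (\<sigma> * t) * (\<sigma>\<^sup>2 * u t + 2 * \<sigma> * v t + (f t - w\<^sup>2 * u t))" for t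
    unfolding d1 by (rule DERIV_imp_deriv)
  show ?thesis
  proof
    show "smooth \<phi>" unfolding \<phi>_def[abs_def] by (intro smooth_mult smooth_exp su)
    show "\<phi> t = 0" if "t \<ge> b" for t using that by (simp add: \<phi>_def u_def P(2) Q(2))
    fix t
    have "adjoint_op M \<sigma> w \<phi> t = M * (exp (\<sigma> * t) * f t)"
      unfolding adjoint_op_def d2 by (simp add: d1 \<phi>_def algebra_simps power2_eq_square)
    also have "\<dots> = \<psi> t" using M by (simp add: f_def exp_minus)
    finally show "adjoint_op M \<sigma> w \<phi> t = \<psi> t" .
  qed
qed

text \<open>The difference of two fundamental solutions annihilates every function of the form
  \<open>adjoint_op M \<sigma> w \<theta>\<close> with \<open>\<theta>\<close> a test function. Given a test function \<open>\<psi>\<close>, the backward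
  solution \<open>\<phi>\<close> of the adjoint equation may have support unbounded on the left; cutting it off there
  gives a test function \<open>\<theta>\<close> that satisfies the equation only on \<open>t > - 1\<close>. That is enough, since
  the difference vanishes on the negative half-line. So the difference annihilates \<open>\<psi>\<close> itself.\<close>

lemma fundamental_solution_unique:
  assumes M: "M > 0" and h1: "fundamental_solution M \<sigma> w h1" and h2: "fundamental_solution M \<sigma> w h2"
  shows "AE t in lebesgue. h1 t = h2 t"
proof -
  have l: "locally_integrable h1" "locally_integrable h2"
    using h1 h2 by (auto simp: fundamental_solution_def)
  define g where "g t = h1 t - h2 t" for t
  have lg: "locally_integrable g"
    using l unfolding locally_integrable_def g_def[abs_def] by (auto intro: set_integral_diff(1))
  have "AE t in lebesgue. g t = 0"
  proof (rule fundamental_lemma_of_variations[OF lg])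
    fix \<psi> assume "test_function \<psi>"
    then obtain a b where \<psi>: "smooth \<psi>" and z: "\<forall>x. x \<notin> {a..b} \<longrightarrow> \<psi> x = 0"
      by (auto simp: test_function_iff)
    obtain \<phi> where \<phi>: "smooth \<phi>" "\<And>t. adjoint_op M \<sigma> w \<phi> t = \<psi> t" "\<And>t. t \<ge> b \<Longrightarrow> \<phi> t = 0"
      using adjoint_equation_solvable[OF M \<psi>, of b \<sigma> w] z by auto
    obtain \<eta> where \<eta>: "smooth \<eta>" "\<And>x. x \<ge> -1 \<Longrightarrow> \<eta> x = 1" "\<And>x. x \<le> -2 \<Longrightarrow> \<eta> x = 0"
      using smooth_cutoff by blast
    define \<theta> where "\<theta> t = \<eta> t * \<phi> t" for t
    have "\<forall>x. x \<notin> {-2..b} \<longrightarrow> \<theta> x = 0"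
      using \<phi>(3) \<eta>(3) by (auto simp: \<theta>_def)
    moreover have s\<theta>: "smooth \<theta>" unfolding \<theta>_def[abs_def] by (intro smooth_mult \<eta> \<phi>)
    ultimately have test: "test_function \<theta>" unfolding test_function_iff by blast
    have e0: "\<theta> t = \<phi> t" if "t \<in> {-1<..}" for t using \<eta>(2) that by (simp add: \<theta>_def)
    have e1: "deriv \<theta> t = deriv \<phi> t" if "t \<in> {-1<..}" for t
      by (rule DERIV_imp_deriv, rule has_field_derivative_transform_within_open[OF smooth_has_deriv[OF \<phi>(1)] _ that])
         (use e0 in auto)
    have e2: "deriv (deriv \<theta>) t = deriv (deriv \<phi>) t" if "t \<in> {-1<..}" for t
      by (rule DERIV_imp_deriv, rule has_field_derivative_transform_within_open[OF smooth_has_deriv[OF smooth_deriv[OF \<phi>(1)]] _ that])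
         (use e1 in auto)
    have "g t * \<psi> t = h1 t * adjoint_op M \<sigma> w \<theta> t - h2 t * adjoint_op M \<sigma> w \<theta> t" for t
    proof (cases "t < 0")
      case True then show ?thesis using h1 h2 by (simp add: g_def fundamental_solution_def)
    next
      case False
      then have "t \<in> {-1<..}" by simp
      from e0[OF this] e1[OF this] e2[OF this]
      have "adjoint_op M \<sigma> w \<theta> t = \<psi> t" using \<phi>(2)[of t] by (simp add: adjoint_op_def)
      then show ?thesis by (simp add: g_def algebra_simps)
    qed
    then have "(LINT t|lebesgue. g t * \<psi> t) = \<theta> 0 - \<theta> 0"
      using h1 h2 test integrable_mult_adjoint_op(1)[OF l(1) test] integrable_mult_adjoint_op(1)[OF l(2) test]
      by (simp add: fundamental_solution_def)
    then show "(LINT t|lebesgue. g t * \<psi> t) = 0" by simp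
  qed
  then show ?thesis by (simp add: g_def)
qed

text \<open>A null set contains no nonempty open set, so the functions agree on \<open>t > 0\<close>; continuity
  extends this to \<open>0\<close>.\<close>

lemma AE_eq_imp_eq_on_halfline:
  fixes f g :: "real \<Rightarrow> real"
  assumes f: "continuous_on {0..} f" and g: "continuous_on {0..} g"
    and ae: "AE t in lebesgue. 0 \<le> t \<longrightarrow> f t = g t" and "t \<ge> 0"
  shows "f t = g t"
proof -
  define d where "d t = f (max t 0) - g (max t 0)" for t
  have c: "continuous_on UNIV d" unfolding d_def[abs_def]
    by (intro continuous_intros continuous_on_compose2[OF f] continuous_on_compose2[OF g]) auto
  have "d t = 0" if "t \<in> {0<..}" for t
  proof -
    have "t \<in> {t. d t = 0}"
    proof (rule mem_closed_if_AE_lebesgue_open[OF _ _ _ that])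
      show "closed {t. d t = 0}"
        using continuous_closed_preimage_constant[OF c, of 0] by simp
      show "AE t\<in>{0<..} in lebesgue. t \<in> {t. d t = 0}"
        using ae by eventually_elim (auto simp: d_def)
    qed simp
    then show ?thesis by simp
  qed
  moreover have "t \<in> closure {0<..}" using \<open>t \<ge> 0\<close> by simp
  ultimately have "d t = 0"
    using continuous_constant_on_closure[OF continuous_on_subset[OF c]] by blast
  then show ?thesis using \<open>t \<ge> 0\<close> by (simp add: d_def)
qed

text \<open>These identities are where \<open>\<bar>\<zeta>\<bar> \<le> 1\<close> enters: it makes the argument of the root in the damped
  frequency nonnegative, so that the root squares back to \<open>1 - \<zeta>\<^sup>2\<close>.\<close>

lemma effective_parameters_complete_square:
  fixes M K C :: real
  assumes "M > 0" "K > 0" "\<bar>C / (2 * sqrt (M * K))\<bar> \<le> 1"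
  defines "\<zeta> \<equiv> C / (2 * sqrt (M * K))" and "\<omega>n \<equiv> sqrt (K / M)"
  shows "C = 2 * M * (\<zeta> * \<omega>n)" and "K = M * ((\<zeta> * \<omega>n)\<^sup>2 + (\<omega>n * sqrt (1 - \<zeta>\<^sup>2))\<^sup>2)"
proof -
  have "\<zeta> * \<omega>n = C * (sqrt K / sqrt M) / (2 * (sqrt M * sqrt K))"
    by (simp add: \<zeta>_def \<omega>n_def real_sqrt_mult real_sqrt_divide)
  also have "\<dots> = C / (2 * (sqrt M * sqrt M))"
    using assms(1,2) by (simp add: field_simps)
  finally show "C = 2 * M * (\<zeta> * \<omega>n)" using assms(1) by simp
  have "\<zeta>\<^sup>2 \<le> 1" using assms(3) by (simp add: \<zeta>_def abs_square_le_1)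
  then have "(\<zeta> * \<omega>n)\<^sup>2 + (\<omega>n * sqrt (1 - \<zeta>\<^sup>2))\<^sup>2 = \<omega>n\<^sup>2"
    by (simp add: power_mult_distrib algebra_simps)
  then show "K = M * ((\<zeta> * \<omega>n)\<^sup>2 + (\<omega>n * sqrt (1 - \<zeta>\<^sup>2))\<^sup>2)"
    using assms(1,2) by (simp add: \<omega>n_def)
qed

theorem theorem5p2:
  fixes m c k \<omega> :: real and \<alpha> \<beta> lam :: "real \<Rightarrow> real"
  assumes "m > 0" and "c > 0" and "k > 0" and "\<omega> > 0"
    and "1 < \<alpha> \<omega>" and "\<alpha> \<omega> < 3"
    and "0 < \<beta> \<omega>" and "\<beta> \<omega> < 2"
    and "0 \<le> lam \<omega>" and "lam \<omega> < 1"
    and "m_eff m c \<alpha> \<beta> \<omega> > 0"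
    and "\<bar>zeta_eff m c k \<alpha> \<beta> lam \<omega>\<bar> \<le> 1"
  shows
    "(\<exists>!h. vo_impulse_response m c k \<alpha> \<beta> lam \<omega> h \<and> continuous_on UNIV h) \<and>
     (\<forall>h. vo_impulse_response m c k \<alpha> \<beta> lam \<omega> h \<longrightarrow>
        (let M = m_eff m c \<alpha> \<beta> \<omega>;
             \<zeta> = zeta_eff m c k \<alpha> \<beta> lam \<omega>;
             \<omega>n = omega_effn m c k \<alpha> \<beta> lam \<omega>;
             \<omega>d = omega_effd m c k \<alpha> \<beta> lam \<omega>;
             r = (\<lambda>t. exp (- \<zeta> * \<omega>n * t) * (1 / M) * sin_quot \<omega>d t)
         in (AE t in lebesgue. 0 \<le> t \<longrightarrow> h t = r t) \<and>
            (continuous_on {0..} h \<longrightarrow> (\<forall>t\<ge>0. h t = r t))))"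
proof -
  define M where "M = m_eff m c \<alpha> \<beta> \<omega>"
  define K where "K = k_eff k lam \<omega>"
  define C where "C = c_eff m c k \<alpha> \<beta> lam \<omega>"
  define \<zeta> where "\<zeta> = zeta_eff m c k \<alpha> \<beta> lam \<omega>"
  define \<omega>n where "\<omega>n = omega_effn m c k \<alpha> \<beta> lam \<omega>"
  define w where "w = omega_effd m c k \<alpha> \<beta> lam \<omega>"
  define \<sigma> where "\<sigma> = \<zeta> * \<omega>n"
  let ?r = "\<lambda>t. exp (- \<zeta> * \<omega>n * t) * (1 / M) * sin_quot w t"
  have M: "M > 0" using assms by (simp add: M_def)
  \<comment> \<open>The order of the restoring term lies in \<open>[0, 1)\<close>, so its cosine, hence the stiffness, is positive.\<close>
  have "lam \<omega> * pi / 2 < pi / 2" "lam \<omega> * pi / 2 \<ge> 0"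
    using assms by auto
  then have "cos (lam \<omega> * pi / 2) > 0" using pi_gt_zero by (intro cos_gt_zero_pi) linarith+
  then have K: "K > 0" using assms by (simp add: K_def k_eff_def)
  have \<zeta>: "\<zeta> = C / (2 * sqrt (M * K))" by (simp add: \<zeta>_def zeta_eff_def C_def M_def K_def)
  have \<omega>n: "\<omega>n = sqrt (K / M)" by (simp add: \<omega>n_def omega_effn_def M_def K_def)
  have w: "w = \<omega>n * sqrt (1 - \<zeta>\<^sup>2)" by (simp add: w_def omega_effd_def \<omega>n_def \<zeta>_def)
  have "C = 2 * M * \<sigma>" "K = M * (\<sigma>\<^sup>2 + w\<^sup>2)"
    unfolding \<sigma>_def w unfolding \<zeta> \<omega>n
    using effective_parameters_complete_square[OF M K, of C] assms(12)[folded \<zeta>_def] \<zeta> by simp_all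
  then have iff: "vo_impulse_response m c k \<alpha> \<beta> lam \<omega> h \<longleftrightarrow> fundamental_solution M \<sigma> w h" for h
    by (intro vo_impulse_response_iff) (simp_all add: M_def C_def K_def)
  let ?h = "causal_response M \<sigma> w"
  note sol = causal_response_solves[OF M, of \<sigma> w]
  have r: "?h t = ?r t" if "t \<ge> 0" for t
    using that by (simp add: causal_response_def \<sigma>_def)
  have ae: "AE t in lebesgue. 0 \<le> t \<longrightarrow> h t = ?h t" if "fundamental_solution M \<sigma> w h" for h
    using fundamental_solution_unique[OF M that sol] by eventually_elim simp
  have eq: "h t = ?h t" if "fundamental_solution M \<sigma> w h" "continuous_on {0..} h" "t \<ge> 0" for h t
    using AE_eq_imp_eq_on_halfline[OF that(2) continuous_causal_response ae[OF that(1)] that(3)] .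
  have "\<exists>!h. fundamental_solution M \<sigma> w h \<and> continuous_on UNIV h"
  proof (rule ex1I)
    show "fundamental_solution M \<sigma> w ?h \<and> continuous_on UNIV ?h"
      using sol continuous_causal_response by blast
    fix h assume h: "fundamental_solution M \<sigma> w h \<and> continuous_on UNIV h"
    show "h = ?h"
    proof
      fix t show "h t = ?h t"
      proof (cases "t < 0")
        case True then show ?thesis using h sol by (simp add: fundamental_solution_def)
      next
        case False then show ?thesis using eq h continuous_on_subset by fastforce
      qed
    qed
  qed
  moreover have "(AE t in lebesgue. 0 \<le> t \<longrightarrow> h t = ?r t) \<and>
      (continuous_on {0..} h \<longrightarrow> (\<forall>t\<ge>0. h t = ?r t))" if "fundamental_solution M \<sigma> w h" for h
  proof
    show "AE t in lebesgue. 0 \<le> t \<longrightarrow> h t = ?r t"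
      using ae[OF that] by eventually_elim (use r in auto)
    show "continuous_on {0..} h \<longrightarrow> (\<forall>t\<ge>0. h t = ?r t)"
      using eq[OF that] r by auto
  qed
  ultimately show ?thesis
    unfolding iff Let_def M_def \<zeta>_def \<omega>n_def w_def by blast
qed

end
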